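(* Let $\mathcal{C}$ be a Riemannian manifold and let $\eta$ be a map assigning to each $(y,x)\in\mathcal{C}\times\mathcal{C}$ a tangent vector $\eta(y,x)\in T_x\mathcal{C}$, with $\mathcal{C}$ an $\eta$-invex set satisfying the triangle inequality assumption with constants $b,c>0$. Let $f:\mathcal{C}\to\mathbb{R}$ be $L$-smooth (with respect to $\eta$, $L>0$) and $\eta$-invex. Let $x^*\in\arg\min_{x\in\mathcal{C}}f(x)$ with $f(x^* )>-\infty$, and let $x_0\in\mathcal{C}$ satisfy $\|\eta(x_0,x^* )\|\le M<\infty$. Let $\alpha\in(0,\frac{2}{L})$ and let $(x_k)_{k\ge0}$ be a sequence in $\mathcal{C}$ starting at $x_0$ with $\eta(x_{k+1},x_k)=-\alpha\nabla f(x_k)$ for all $k\ge0$. Then $f(x_k)$ converges to $f(x^* )$ at the rate $O(1/k)$, i.e. there is a constant $K$ independent of $k$ such that $f(x_k)-f(x^* )\le \frac{K}{k}$ for all $k\ge1$.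
   Context: $\langle\cdot,\cdot\rangle_x$ is the inner product on $T_x\mathcal{C}$ given by the Riemannian metric, $\|\cdot\|$ (or $\|\cdot\|_x$) is the induced norm on $T_x\mathcal{C}$ (so $\|\eta(y,x)\|$ is taken in $T_x\mathcal{C}$), and $\nabla f(x)\in T_x\mathcal{C}$ is the Riemannian gradient. $\eta$-invex set: a set $\mathcal{A}\subseteq\mathcal{C}$ is $\eta$-invex if it contains every differentiable curve $\gamma_{x,y}:[0,1]\to\mathcal{C}$ with endpoints $\gamma_{x,y}(0)=x\in\mathcal{A}$, $\gamma_{x,y}(1)=y\in\mathcal{A}$ satisfying $\dot\gamma_{x,y}(u)(t-u)=\eta(\gamma_{x,y}(t),\gamma_{x,y}(u))$ for all $t,u\in[0,1]$. $\eta$-invex function: a differentiable $f:\mathcal{C}\to\mathbb{R}$ is $\eta$-invex if $f(y)-f(x)\ge\langle\eta(y,x),\nabla f(x)\rangle_x$ for all $x,y\in\mathcal{C}$. $L$-smooth: a differentiable $f$ is $L$-smooth (with respect to $\eta$) if for all $x,y\in\mathcal{C}$, $f(y)\le f(x)+\langle\eta(y,x),\nabla f(x)\rangle_x+\frac{L}{2}\|\eta(y,x)\|_x^2$. Triangle inequality assumption (constants $b,c>0$): for all $x,y,z\in\mathcal{C}$, $\|\eta(y,z)\|_z^2\le\|\eta(x,z)\|_z^2+b\|\eta(y,x)\|_x^2-c\langle\eta(y,x),\eta(z,x)\rangle_x$. *)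

theory Defs
  imports "HOL-Analysis.Analysis"
begin

section \<open>Smooth maps between open sets of normed spaces\<close>

text \<open>These two predicates are meant for open \<open>S\<close>.\<close>

primrec Ck_on ::
  "nat \<Rightarrow> ('e::real_normed_vector \<Rightarrow> 'f::real_normed_vector) \<Rightarrow> 'e set \<Rightarrow> bool" where
  "Ck_on 0 f S \<longleftrightarrow> continuous_on S f"
| "Ck_on (Suc k) f S \<longleftrightarrow>
     f differentiable_on S \<and> (\<forall>v. Ck_on k (\<lambda>p. frechet_derivative f (at p) v) S)"

definition smooth_on ::
  "('e::real_normed_vector \<Rightarrow> 'f::real_normed_vector) \<Rightarrow> 'e set \<Rightarrow> bool" where
  "smooth_on f S \<longleftrightarrow> (\<forall>k. Ck_on k f S)"


section \<open>Smooth manifolds\<close>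

text \<open>A chart is a pair \<open>(U, \<phi>)\<close> of a domain and a coordinate map; only the values of
  \<open>\<phi>\<close> on \<open>U\<close> matter. The model space is a Euclidean space \<open>'e\<close>.\<close>

type_synonym ('a, 'e) chart = "'a set \<times> ('a \<Rightarrow> 'e)"

definition chart_inv :: "('a, 'e) chart \<Rightarrow> 'e \<Rightarrow> 'a" where
  "chart_inv c = inv_into (fst c) (snd c)"

definition is_chart :: "'a topology \<Rightarrow> ('a, 'e::euclidean_space) chart \<Rightarrow> bool" where
  "is_chart X c \<longleftrightarrow>
     openin X (fst c) \<and> open (snd c ` fst c) \<and>
     homeomorphic_map (subtopology X (fst c)) (top_of_set (snd c ` fst c)) (snd c)"

definition transition :: "('a, 'e) chart \<Rightarrow> ('a, 'e) chart \<Rightarrow> 'e \<Rightarrow> 'e" where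
  "transition c d = snd d \<circ> chart_inv c"

locale smooth_manifold =
  fixes X :: "'a topology" and A :: "('a, 'e::euclidean_space) chart set"
  assumes Hausdorff: "Hausdorff_space X"
    and second_countable: "second_countable X"
    and charts: "\<And>c. c \<in> A \<Longrightarrow> is_chart X c"
    and cover: "topspace X \<subseteq> (\<Union>c\<in>A. fst c)"
    and compatible: "\<And>c d. c \<in> A \<Longrightarrow> d \<in> A \<Longrightarrow>
      smooth_on (transition c d) (snd c ` (fst c \<inter> fst d))"


section \<open>Tangent vectors\<close>

text \<open>A tangent vector at \<open>x\<close> is a family of coordinate vectors, one for each chart of the
  atlas around \<open>x\<close>, that transforms by the derivatives of the transition maps. At all other
  pairs \<open>c\<close> (charts not containing \<open>x\<close>, or not in the atlas) the family is \<open>0\<close>, so that equal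
  tangent vectors are equal as functions. The linear structure is pointwise.\<close>

type_synonym ('a, 'e) tvec = "('a, 'e) chart \<Rightarrow> 'e"

definition tangent_space :: "('a, 'e::euclidean_space) chart set \<Rightarrow> 'a \<Rightarrow> ('a, 'e) tvec set" where
  "tangent_space A x =
     {v. (\<forall>c. \<not> (c \<in> A \<and> x \<in> fst c) \<longrightarrow> v c = 0) \<and>
         (\<forall>c\<in>A. \<forall>d\<in>A. x \<in> fst c \<and> x \<in> fst d \<longrightarrow>
            v d = frechet_derivative (transition c d) (at (snd c x)) (v c))}"

definition tadd :: "('a, 'e::euclidean_space) tvec \<Rightarrow> ('a, 'e) tvec \<Rightarrow> ('a, 'e) tvec" where
  "tadd v w = (\<lambda>c. v c + w c)"

definition tscale :: "real \<Rightarrow> ('a, 'e::euclidean_space) tvec \<Rightarrow> ('a, 'e) tvec" where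
  "tscale r v = (\<lambda>c. r *\<^sub>R v c)"

text \<open>The tangent vector at \<open>x\<close> with coordinates \<open>a\<close> in the chart \<open>c\<close>. For fixed \<open>a\<close> and
  varying \<open>x\<close> this is a constant-coefficient combination of the coordinate fields of \<open>c\<close>.\<close>

definition coord_tvec ::
  "('a, 'e::euclidean_space) chart set \<Rightarrow> ('a, 'e) chart \<Rightarrow> 'a \<Rightarrow> 'e \<Rightarrow> ('a, 'e) tvec" where
  "coord_tvec A c x a =
     (\<lambda>d. if d \<in> A \<and> x \<in> fst d
          then frechet_derivative (transition c d) (at (snd c x)) a else 0)"


section \<open>Riemannian metrics and gradients\<close>

locale riemannian_manifold = smooth_manifold X A
  for X :: "'a topology" and A :: "('a, 'e::euclidean_space) chart set" +
  fixes g :: "'a \<Rightarrow> ('a, 'e) tvec \<Rightarrow> ('a, 'e) tvec \<Rightarrow> real"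
  assumes metric_add: "\<And>x u v w. x \<in> topspace X \<Longrightarrow> u \<in> tangent_space A x \<Longrightarrow>
      v \<in> tangent_space A x \<Longrightarrow> w \<in> tangent_space A x \<Longrightarrow>
      g x (tadd u v) w = g x u w + g x v w"
    and metric_scale: "\<And>x r v w. x \<in> topspace X \<Longrightarrow> v \<in> tangent_space A x \<Longrightarrow>
      w \<in> tangent_space A x \<Longrightarrow> g x (tscale r v) w = r * g x v w"
    and metric_sym: "\<And>x v w. x \<in> topspace X \<Longrightarrow> v \<in> tangent_space A x \<Longrightarrow>
      w \<in> tangent_space A x \<Longrightarrow> g x v w = g x w v"
    and metric_pos: "\<And>x v. x \<in> topspace X \<Longrightarrow> v \<in> tangent_space A x \<Longrightarrow>
      v \<noteq> (\<lambda>c. 0) \<Longrightarrow> g x v v > 0"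
    and metric_smooth: "\<And>c a b. c \<in> A \<Longrightarrow>
      smooth_on (\<lambda>p. g (chart_inv c p) (coord_tvec A c (chart_inv c p) a)
                                       (coord_tvec A c (chart_inv c p) b)) (snd c ` fst c)"

definition tnorm ::
  "('a \<Rightarrow> ('a, 'e) tvec \<Rightarrow> ('a, 'e) tvec \<Rightarrow> real) \<Rightarrow> 'a \<Rightarrow> ('a, 'e::euclidean_space) tvec \<Rightarrow> real" where
  "tnorm g x v = sqrt (g x v v)"

definition differentiable_fun ::
  "'a topology \<Rightarrow> ('a, 'e::euclidean_space) chart set \<Rightarrow> ('a \<Rightarrow> real) \<Rightarrow> bool" where
  "differentiable_fun X A f \<longleftrightarrow>
     (\<forall>x\<in>topspace X. \<forall>c\<in>A. x \<in> fst c \<longrightarrow> (f \<circ> chart_inv c) differentiable (at (snd c x)))"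

text \<open>The Riesz representative of the differential \<open>df\<^sub>x\<close>; the latter is written
  \<open>w \<mapsto> D(f \<circ> c\<^sup>-\<^sup>1)(c x)(w\<^sub>c)\<close> in every chart \<open>c\<close> around \<open>x\<close>, and by the chain rule this
  value does not depend on \<open>c\<close>.\<close>

definition gradient ::
  "('a, 'e::euclidean_space) chart set \<Rightarrow> ('a \<Rightarrow> ('a, 'e) tvec \<Rightarrow> ('a, 'e) tvec \<Rightarrow> real) \<Rightarrow>
   ('a \<Rightarrow> real) \<Rightarrow> 'a \<Rightarrow> ('a, 'e) tvec" where
  "gradient A g f x =
     (THE v. v \<in> tangent_space A x \<and>
        (\<forall>w\<in>tangent_space A x. \<forall>c\<in>A. x \<in> fst c \<longrightarrow>
           g x v w = frechet_derivative (f \<circ> chart_inv c) (at (snd c x)) (w c)))"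


section \<open>Differentiable curves on the unit interval\<close>

definition differentiable_curve ::
  "'a topology \<Rightarrow> ('a, 'e::euclidean_space) chart set \<Rightarrow> (real \<Rightarrow> 'a) \<Rightarrow> bool" where
  "differentiable_curve X A \<gamma> \<longleftrightarrow>
     continuous_map (top_of_set {0..1}) X \<gamma> \<and>
     (\<forall>u\<in>{0..1}. \<forall>c\<in>A. \<gamma> u \<in> fst c \<longrightarrow> (snd c \<circ> \<gamma>) differentiable (at u within {0..1}))"

definition velocity ::
  "('a, 'e::euclidean_space) chart set \<Rightarrow> (real \<Rightarrow> 'a) \<Rightarrow> real \<Rightarrow> ('a, 'e) tvec" where
  "velocity A \<gamma> u =
     (\<lambda>c. if c \<in> A \<and> \<gamma> u \<in> fst c
          then vector_derivative (snd c \<circ> \<gamma>) (at u within {0..1}) else 0)"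


section \<open>Invexity, smoothness and the triangle inequality with respect to \<open>\<eta>\<close>\<close>

definition eta_invex_set ::
  "'a topology \<Rightarrow> ('a, 'e::euclidean_space) chart set \<Rightarrow> ('a \<Rightarrow> 'a \<Rightarrow> ('a, 'e) tvec) \<Rightarrow>
   'a set \<Rightarrow> bool" where
  "eta_invex_set X A \<eta> S \<longleftrightarrow> S \<subseteq> topspace X \<and>
     (\<forall>\<gamma>. differentiable_curve X A \<gamma> \<and> \<gamma> 0 \<in> S \<and> \<gamma> 1 \<in> S \<and>
        (\<forall>t\<in>{0..1}. \<forall>u\<in>{0..1}. tscale (t - u) (velocity A \<gamma> u) = \<eta> (\<gamma> t) (\<gamma> u))
        \<longrightarrow> \<gamma> ` {0..1} \<subseteq> S)"

definition eta_invex_fun ::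
  "'a topology \<Rightarrow> ('a, 'e::euclidean_space) chart set \<Rightarrow>
   ('a \<Rightarrow> ('a, 'e) tvec \<Rightarrow> ('a, 'e) tvec \<Rightarrow> real) \<Rightarrow> ('a \<Rightarrow> 'a \<Rightarrow> ('a, 'e) tvec) \<Rightarrow>
   ('a \<Rightarrow> real) \<Rightarrow> bool" where
  "eta_invex_fun X A g \<eta> f \<longleftrightarrow> differentiable_fun X A f \<and>
     (\<forall>x\<in>topspace X. \<forall>y\<in>topspace X. f y - f x \<ge> g x (\<eta> y x) (gradient A g f x))"

definition L_smooth ::
  "'a topology \<Rightarrow> ('a, 'e::euclidean_space) chart set \<Rightarrow>
   ('a \<Rightarrow> ('a, 'e) tvec \<Rightarrow> ('a, 'e) tvec \<Rightarrow> real) \<Rightarrow> ('a \<Rightarrow> 'a \<Rightarrow> ('a, 'e) tvec) \<Rightarrow>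
   real \<Rightarrow> ('a \<Rightarrow> real) \<Rightarrow> bool" where
  "L_smooth X A g \<eta> L f \<longleftrightarrow> differentiable_fun X A f \<and>
     (\<forall>x\<in>topspace X. \<forall>y\<in>topspace X.
        f y \<le> f x + g x (\<eta> y x) (gradient A g f x) + L / 2 * (tnorm g x (\<eta> y x))\<^sup>2)"

definition eta_triangle ::
  "'a topology \<Rightarrow> ('a \<Rightarrow> ('a, 'e::euclidean_space) tvec \<Rightarrow> ('a, 'e) tvec \<Rightarrow> real) \<Rightarrow>
   ('a \<Rightarrow> 'a \<Rightarrow> ('a, 'e) tvec) \<Rightarrow> real \<Rightarrow> real \<Rightarrow> bool" where
  "eta_triangle X g \<eta> b c \<longleftrightarrow>
     (\<forall>x\<in>topspace X. \<forall>y\<in>topspace X. \<forall>z\<in>topspace X.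
        (tnorm g z (\<eta> y z))\<^sup>2 \<le> (tnorm g z (\<eta> x z))\<^sup>2 + b * (tnorm g x (\<eta> y x))\<^sup>2
                               - c * g x (\<eta> y x) (\<eta> z x))"

end

theory Submission
  imports Defs
begin

text \<open>
  Write \<open>G\<^sub>k\<close> for the gradient at \<open>x\<^sub>k\<close>. Smoothness along a step gives the descent
  \<open>f(x\<^sub>k) - f(x\<^sub>k\<^sub>+\<^sub>1) \<ge> \<delta> \<parallel>G\<^sub>k\<parallel>\<^sup>2\<close> with \<open>\<delta> = \<alpha>(1 - L\<alpha>/2) > 0\<close>. The triangle inequality at
  \<open>(x\<^sub>k, x\<^sub>k\<^sub>+\<^sub>1, x\<^sup>*)\<close>, combined with invexity, bounds \<open>c\<alpha>(f(x\<^sub>k) - f(x\<^sup>*))\<close> by the decrease of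
  \<open>\<parallel>\<eta>(x\<^sub>k, x\<^sup>*)\<parallel>\<^sup>2\<close> plus \<open>b\<alpha>\<^sup>2\<parallel>G\<^sub>k\<parallel>\<^sup>2\<close>, and the descent estimate absorbs the last term. Hence
  \<open>\<parallel>\<eta>(x\<^sub>k, x\<^sup>*)\<parallel>\<^sup>2 + (b\<alpha>\<^sup>2/\<delta>)(f(x\<^sub>k) - f(x\<^sup>*))\<close> is a Lyapunov function decreasing by at least
  \<open>c\<alpha>(f(x\<^sub>k) - f(x\<^sup>*))\<close> in each step; telescoping and monotonicity of \<open>f(x\<^sub>k)\<close> give the rate.
\<close>

text \<open>Summing \<open>decrease\<close> over \<open>j < k\<close> telescopes to at most
  \<open>\<Phi> 0\<close>, and since \<open>e\<close> is antitone each of the \<open>k\<close>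
  summands \<open>e j\<close> is at least \<open>e k\<close>.\<close>

lemma antimono_le_of_lyapunov:
  fixes e \<Phi> :: "nat \<Rightarrow> real"
  assumes "C > 0" and mono: "\<And>k. e (Suc k) \<le> e k" and nonneg: "\<And>k. 0 \<le> \<Phi> k"
    and decrease: "\<And>k. C * e k \<le> \<Phi> k - \<Phi> (Suc k)"
    and "k \<ge> 1"
  shows "e k \<le> (\<Phi> 0 / C) / real k"
proof -
  have "decseq e" using mono by (rule decseq_SucI)
  then have "real k * e k \<le> (\<Sum>j<k. e j)"
    using sum_bounded_below[of "{..<k}" "e k" e] by (simp add: decseq_def)
  then have "C * (real k * e k) \<le> C * (\<Sum>j<k. e j)"
    using \<open>C > 0\<close> by (intro mult_left_mono) auto
  also have "\<dots> \<le> (\<Sum>j<k. \<Phi> j - \<Phi> (Suc j))"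
    by (simp add: sum_distrib_left sum_mono decrease)
  also have "\<dots> = \<Phi> 0 - \<Phi> k" by (rule sum_lessThan_telescope')
  also have "\<dots> \<le> \<Phi> 0" using nonneg[of k] by simp
  finally show ?thesis using \<open>C > 0\<close> \<open>k \<ge> 1\<close> by (simp add: field_simps)
qed

context smooth_manifold
begin

text \<open>Openness turns the \<open>differentiable_on\<close> in \<open>Ck_on\<close> into
  differentiability at a point, as \<open>frechet_derivative\<close> at \<open>snd c x\<close>
  requires. It holds because a homeomorphism is an open map and the chart image is open.\<close>

lemma open_transition_domain:
  assumes "c \<in> A" "d \<in> A"
  shows "open (snd c ` (fst c \<inter> fst d))"
proof -
  have c: "openin X (fst c)" "open (snd c ` fst c)"
    and hom: "homeomorphic_map (subtopology X (fst c)) (top_of_set (snd c ` fst c)) (snd c)"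
    and "openin X (fst d)"
    using charts[OF assms(1)] charts[OF assms(2)] by (auto simp: is_chart_def)
  then have "openin (subtopology X (fst c)) (fst c \<inter> fst d)"
    by (simp add: openin_subtopology_Int2)
  then have "openin (top_of_set (snd c ` fst c)) (snd c ` (fst c \<inter> fst d))"
    using homeomorphic_imp_open_map[OF hom] by (simp add: open_map_def)
  then show ?thesis using c(2) by (rule openin_open_trans)
qed

lemma linear_transition_derivative:
  assumes "c \<in> A" "d \<in> A" "x \<in> fst c" "x \<in> fst d"
  shows "linear (frechet_derivative (transition c d) (at (snd c x)))"
proof -
  let ?S = "snd c ` (fst c \<inter> fst d)"
  have "Ck_on (Suc 0) (transition c d) ?S"
    using compatible[OF assms(1,2)] unfolding smooth_on_def by blast
  then have "transition c d differentiable_on ?S" by simp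
  then have "transition c d differentiable (at (snd c x))"
    using open_transition_domain[OF assms(1,2)] assms(3,4)
    by (metis IntI differentiable_on_eq_differentiable_at imageI)
  then show ?thesis by (rule linear_frechet_derivative)
qed

lemma tscale_in_tangent_space:
  assumes "v \<in> tangent_space A x"
  shows "tscale r v \<in> tangent_space A x"
  unfolding tangent_space_def
proof (intro CollectI conjI allI ballI impI)
  fix c
  assume "\<not> (c \<in> A \<and> x \<in> fst c)"
  then have "v c = 0" using assms unfolding tangent_space_def by blast
  then show "tscale r v c = 0" by (simp add: tscale_def)
next
  fix c d
  assume cd: "c \<in> A" "d \<in> A" "x \<in> fst c \<and> x \<in> fst d"
  then have "v d = frechet_derivative (transition c d) (at (snd c x)) (v c)"
    using assms unfolding tangent_space_def by blast
  then show "tscale r v d = frechet_derivative (transition c d) (at (snd c x)) (tscale r v c)"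
    using cd by (simp only: tscale_def linear_scale[OF linear_transition_derivative])
qed

text \<open>Read from left to right, this recovers tangency of the gradient from tangency of the
  step.\<close>

lemma tscale_in_tangent_space_iff:
  assumes "r \<noteq> 0"
  shows "tscale r v \<in> tangent_space A x \<longleftrightarrow> v \<in> tangent_space A x"
proof -
  have "tscale (inverse r) (tscale r v) = v"
    using assms by (simp add: tscale_def)
  then show ?thesis by (metis tscale_in_tangent_space)
qed

end

context riemannian_manifold
begin

lemma metric_nonneg:
  assumes "x \<in> topspace X" "v \<in> tangent_space A x"
  shows "0 \<le> g x v v"
proof (cases "v = (\<lambda>c. 0)")
  case True
  \<comment> \<open>\<open>metric_pos\<close> excludes the zero vector; there homogeneity with
    factor 0 gives \<open>g x v v = 0\<close>.\<close>
  then have "tscale 0 v = v" by (simp add: tscale_def)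
  then show ?thesis using metric_scale[OF assms assms(2), of 0] by simp
next
  case False
  then show ?thesis using metric_pos[OF assms] by simp
qed

lemma tnorm_power2:
  assumes "x \<in> topspace X" "v \<in> tangent_space A x"
  shows "(tnorm g x v)\<^sup>2 = g x v v"
  using metric_nonneg[OF assms] by (simp add: tnorm_def)

lemma metric_scale_right:
  assumes "x \<in> topspace X" "v \<in> tangent_space A x" "w \<in> tangent_space A x"
  shows "g x v (tscale r w) = r * g x v w"
  using assms tscale_in_tangent_space[OF assms(3)]
  by (simp add: metric_scale metric_sym[OF assms(1,2)])

lemma tnorm_tscale_power2:
  assumes "x \<in> topspace X" "v \<in> tangent_space A x"
  shows "(tnorm g x (tscale r v))\<^sup>2 = r\<^sup>2 * g x v v"
  using assms
  \<comment> \<open>Squares are expanded only in the second pass, so that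
    \<open>tnorm_power2\<close> can match first.\<close>
  by (simp add: tnorm_power2 tscale_in_tangent_space metric_scale metric_scale_right)
    (simp add: power2_eq_square)

context
  fixes \<eta> :: "'a \<Rightarrow> 'a \<Rightarrow> ('a, 'e) tvec" and f :: "'a \<Rightarrow> real" and \<alpha> :: real and p q :: 'a
  assumes tangent: "\<And>p q. p \<in> topspace X \<Longrightarrow> q \<in> topspace X \<Longrightarrow> \<eta> q p \<in> tangent_space A p"
    and p: "p \<in> topspace X" and q: "q \<in> topspace X"
    and \<alpha>: "\<alpha> \<noteq> 0"
    and step: "\<eta> q p = tscale (- \<alpha>) (gradient A g f p)"
begin

text \<open>This avoids proving that the description in \<open>gradient\<close> is satisfied: the step itself is a
  nonzero multiple of the gradient.\<close>

lemma gradient_step_in_tangent_space: "gradient A g f p \<in> tangent_space A p"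
  using tangent[OF p q] \<alpha> by (simp add: step tscale_in_tangent_space_iff)

text \<open>Inserting the step, the linear term of the smoothness bound becomes
  \<open>- \<alpha>\<close> and the quadratic one \<open>L * \<alpha>\<^sup>2 / 2\<close> times the
  squared gradient norm.\<close>

lemma gradient_step_descent:
  assumes "L_smooth X A g \<eta> L f"
  shows "\<alpha> * (1 - L * \<alpha> / 2) * g p (gradient A g f p) (gradient A g f p) \<le> f p - f q"
proof -
  have "f q \<le> f p + g p (\<eta> q p) (gradient A g f p) + L / 2 * (tnorm g p (\<eta> q p))\<^sup>2"
    using assms p q by (simp add: L_smooth_def)
  then show ?thesis
    using p gradient_step_in_tangent_space
    by (simp add: step metric_scale tnorm_tscale_power2)
      (simp add: algebra_simps power2_eq_square)
qed

lemma gradient_step_distance: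
  assumes "eta_triangle X g \<eta> b c" and "eta_invex_fun X A g \<eta> f"
    and "0 < c" "0 < \<alpha>" and z: "z \<in> topspace X"
  shows "c * \<alpha> * (f p - f z) \<le> (tnorm g z (\<eta> p z))\<^sup>2 - (tnorm g z (\<eta> q z))\<^sup>2
    + b * \<alpha>\<^sup>2 * g p (gradient A g f p) (gradient A g f p)"
proof -
  let ?G = "gradient A g f p"
  note G = gradient_step_in_tangent_space
  have "g p (\<eta> z p) ?G \<le> f z - f p"
    using assms(2) p z by (simp add: eta_invex_fun_def)
  then have "c * \<alpha> * g p ?G (\<eta> z p) \<le> c * \<alpha> * (f z - f p)"
    \<comment> \<open>Invexity has the gradient in the second slot, the cross term of the triangle
      inequality has it in the first.\<close>
    using \<open>0 < c\<close> \<open>0 < \<alpha>\<close> by (simp add: metric_sym[OF p G tangent[OF p z]])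
  moreover have "(tnorm g z (\<eta> q z))\<^sup>2 \<le> (tnorm g z (\<eta> p z))\<^sup>2 + b * (tnorm g p (\<eta> q p))\<^sup>2
      - c * g p (\<eta> q p) (\<eta> z p)"
    using assms(1) p q z by (simp add: eta_triangle_def)
  ultimately show ?thesis
    by (simp add: step tnorm_tscale_power2[OF p G] metric_scale[OF p G tangent[OF p z]]
        algebra_simps)
qed

end

end

theorem theorem3p6:
  fixes X :: "'a topology"
    and A :: "('a, 'e::euclidean_space) chart set"
    and g :: "'a \<Rightarrow> ('a, 'e) tvec \<Rightarrow> ('a, 'e) tvec \<Rightarrow> real"
    and \<eta> :: "'a \<Rightarrow> 'a \<Rightarrow> ('a, 'e) tvec"
    and f :: "'a \<Rightarrow> real"
    and xs x0 :: 'a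
    and x :: "nat \<Rightarrow> 'a"
    and L b c M \<alpha> :: real
  assumes "riemannian_manifold X A g"
    and "\<And>p q. p \<in> topspace X \<Longrightarrow> q \<in> topspace X \<Longrightarrow> \<eta> q p \<in> tangent_space A p"
    and "eta_invex_set X A \<eta> (topspace X)"
    and "b > 0" and "c > 0" and "eta_triangle X g \<eta> b c"
    and "L > 0" and "L_smooth X A g \<eta> L f"
    and "eta_invex_fun X A g \<eta> f"
    and "is_arg_min f (\<lambda>p. p \<in> topspace X) xs"
    and "x0 \<in> topspace X" and "tnorm g xs (\<eta> x0 xs) \<le> M"
    and "\<alpha> \<in> {0<..<2 / L}"
    and "\<And>k. x k \<in> topspace X" and "x 0 = x0"
    and "\<And>k. \<eta> (x (Suc k)) (x k) = tscale (- \<alpha>) (gradient A g f (x k))"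
  shows "(\<lambda>k. f (x k)) \<longlonglongrightarrow> f xs \<and>
         (\<exists>K. \<forall>k\<ge>1. f (x k) - f xs \<le> K / real k)"
proof -
  interpret riemannian_manifold X A g by fact
  have \<alpha>: "0 < \<alpha>" "L * \<alpha> < 2"
    using assms(7,13) by (auto simp: field_simps)
  have xs: "xs \<in> topspace X" and min: "\<And>p. p \<in> topspace X \<Longrightarrow> f xs \<le> f p"
    using assms(10) by (auto simp: is_arg_min_linorder)
  define \<delta> where "\<delta> = \<alpha> * (1 - L * \<alpha> / 2)"
  define G where "G k = g (x k) (gradient A g f (x k)) (gradient A g f (x k))" for k
  \<comment> \<open>The weight \<open>b * \<alpha>\<^sup>2 / \<delta>\<close> converts the descent
    \<open>\<delta> * G k\<close> into exactly the error term
    \<open>b * \<alpha>\<^sup>2 * G k\<close> of the distance estimate.\<close>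
  define \<Phi> where "\<Phi> k = (tnorm g xs (\<eta> (x k) xs))\<^sup>2 + b * \<alpha>\<^sup>2 / \<delta> * (f (x k) - f xs)" for k
  have \<delta>: "0 < \<delta>" using \<alpha> by (simp add: \<delta>_def)
  have "\<alpha> \<noteq> 0" using \<alpha> by simp
  have G_tangent: "gradient A g f (x k) \<in> tangent_space A (x k)"
    and descent: "\<delta> * G k \<le> f (x k) - f (x (Suc k))"
    and distance: "c * \<alpha> * (f (x k) - f xs)
      \<le> (tnorm g xs (\<eta> (x k) xs))\<^sup>2 - (tnorm g xs (\<eta> (x (Suc k)) xs))\<^sup>2 + b * \<alpha>\<^sup>2 * G k" for k
  proof -
    note at_step = assms(2) assms(14)[of k] assms(14)[of "Suc k"] \<open>\<alpha> \<noteq> 0\<close> assms(16)[of k]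
    show "gradient A g f (x k) \<in> tangent_space A (x k)"
      using gradient_step_in_tangent_space[of \<eta> "x k" "x (Suc k)" \<alpha> f] at_step by blast
    show "\<delta> * G k \<le> f (x k) - f (x (Suc k))"
      unfolding \<delta>_def G_def
      using gradient_step_descent[of \<eta> "x k" "x (Suc k)" \<alpha> f L] at_step assms(8) by blast
    show "c * \<alpha> * (f (x k) - f xs)
      \<le> (tnorm g xs (\<eta> (x k) xs))\<^sup>2 - (tnorm g xs (\<eta> (x (Suc k)) xs))\<^sup>2 + b * \<alpha>\<^sup>2 * G k"
      unfolding G_def
      using gradient_step_distance[of \<eta> "x k" "x (Suc k)" \<alpha> f b c xs] at_step
        assms(5,6,9) \<alpha>(1) xs by blast
  qed
  have G: "0 \<le> G k" for k
    unfolding G_def by (rule metric_nonneg[OF assms(14) G_tangent])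
  have rate: "f (x k) - f xs \<le> (\<Phi> 0 / (c * \<alpha>)) / real k" if "k \<ge> 1" for k
  proof (rule antimono_le_of_lyapunov[where e = "\<lambda>k. f (x k) - f xs"])
    show "c * \<alpha> > 0" using \<alpha> assms(5) by simp
    show "f (x (Suc j)) - f xs \<le> f (x j) - f xs" for j
      using descent[of j] mult_nonneg_nonneg[of \<delta> "G j"] \<delta> G[of j] by linarith
    \<comment> \<open>Minimality of \<open>xs\<close> makes the function gap nonnegative.\<close>
    show "0 \<le> \<Phi> j" for j
      using min[OF assms(14)] assms(4) \<delta> by (simp add: \<Phi>_def)
    show "c * \<alpha> * (f (x j) - f xs) \<le> \<Phi> j - \<Phi> (Suc j)" for j
    proof -
      have "b * \<alpha>\<^sup>2 * G j = b * \<alpha>\<^sup>2 / \<delta> * (\<delta> * G j)" using \<delta> by simp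
      also have "\<dots> \<le> b * \<alpha>\<^sup>2 / \<delta> * (f (x j) - f (x (Suc j)))"
        using descent assms(4) \<delta> by (intro mult_left_mono) auto
      finally show ?thesis
        using distance[of j] by (simp add: \<Phi>_def right_diff_distrib)
    qed
  qed (fact that)
  moreover have "(\<lambda>k. f (x k)) \<longlonglongrightarrow> f xs"
  proof (rule tendsto_sandwich)
    show "\<forall>\<^sub>F k in sequentially. f xs \<le> f (x k)"
      using min assms(14) by simp
    show "\<forall>\<^sub>F k in sequentially. f (x k) \<le> f xs + (\<Phi> 0 / (c * \<alpha>)) / real k"
      \<comment> \<open>The index 0 must be left out: division by zero yields 0, and the bound would
        claim \<open>f (x 0) \<le> f xs\<close>.\<close>
      using eventually_ge_at_top[of 1] by eventually_elim (use rate in force)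
    show "(\<lambda>k. f xs + (\<Phi> 0 / (c * \<alpha>)) / real k) \<longlonglongrightarrow> f xs"
      using tendsto_add[OF tendsto_const[of "f xs"] lim_const_over_n[of "\<Phi> 0 / (c * \<alpha>)"]]
      by simp
  qed simp
  ultimately show ?thesis by blast
qed

end
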